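(* Let $p$ be a prime number and let $\ell,m,s$ be natural numbers (non-negative integers) such that $0<s<p$. Then $$\sum_{j,i\ge \ell}(-1)^{j-i}\binom{m}{j}\binom{j}{i}\binom{j+s-1+i(p-1)}{j+s-1+\ell(p-1)}\equiv 0 \pmod{p^{m-\ell}},$$ and the quotient is an integer-valued polynomial function of $m$ of degree $s-1+\ell(p-1)$; that is, for fixed $p,\ell,s$ there is a polynomial $Q\in\mathbb{Q}[x]$ of degree $s-1+\ell(p-1)$, taking integer values at integers, such that for all integers $m\ge 0$ one has $$\sum_{j,i\ge \ell}(-1)^{j-i}\binom{m}{j}\binom{j}{i}\binom{j+s-1+i(p-1)}{j+s-1+\ell(p-1)}=p^{m-\ell}Q(m).$$
   Context: $\binom{n}{k}$ is the usual binomial coefficient, equal to $0$ when $0\le n<k$; the double sum (over all integers $i,j\ge\ell$) is therefore finite. When $m<\ell$, the congruence modulo $p^{m-\ell}$ is understood as the statement that the sum is $p^{m-\ell}$ times an integer. *)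

theory Defs
  imports
    "HOL-Computational_Algebra.Polynomial"
    "HOL-Computational_Algebra.Primes"
    "HOL-Number_Theory.Cong"
begin

text \<open>
  The subtractions are on \<open>nat\<close>. They do not truncate in \<open>p - 1\<close> and \<open>j + s - 1\<close> when \<open>p\<close> is
  prime and \<open>s > 0\<close>; \<open>j - i\<close> truncates only if \<open>j < i\<close>, where \<open>j choose i = 0\<close>.
\<close>

definition summand :: "nat \<Rightarrow> nat \<Rightarrow> nat \<Rightarrow> nat \<Rightarrow> nat \<Rightarrow> nat \<Rightarrow> int" where
  "summand p l s m j i =
     (-1) ^ (j - i) * int (m choose j) * int (j choose i)
       * int ((j + s - 1 + i * (p - 1)) choose (j + s - 1 + l * (p - 1)))"

text \<open>
  The sum over all \<open>i, j \<ge> l\<close>, taken over the support of the summand. The two lemmas below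
  show that the support is finite and give the sum as an iterated sum over bounded ranges.
\<close>

definition double_sum :: "nat \<Rightarrow> nat \<Rightarrow> nat \<Rightarrow> nat \<Rightarrow> int" where
  "double_sum p l s m =
     (\<Sum>(j, i) | j \<ge> l \<and> i \<ge> l \<and> summand p l s m j i \<noteq> 0. summand p l s m j i)"

lemma summand_support:
  "{(j, i). j \<ge> l \<and> i \<ge> l \<and> summand p l s m j i \<noteq> 0} \<subseteq> (SIGMA j:{l..m}. {l..j})"
  by (auto simp: summand_def)

lemma finite_summand_support:
  "finite {(j, i). j \<ge> l \<and> i \<ge> l \<and> summand p l s m j i \<noteq> 0}"
  by (rule finite_subset[OF summand_support]) auto

lemma double_sum_eq:
  "double_sum p l s m = (\<Sum>j=l..m. \<Sum>i=l..j. summand p l s m j i)"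
proof -
  have "(\<Sum>j=l..m. \<Sum>i=l..j. summand p l s m j i)
      = (\<Sum>(j, i)\<in>(SIGMA j:{l..m}. {l..j}). summand p l s m j i)"
    by (rule sum.Sigma) auto
  also have "\<dots> = double_sum p l s m"
    unfolding double_sum_def
    by (rule sum.mono_neutral_right[OF _ summand_support]) auto
  finally show ?thesis by simp
qed

end

theory Submission
  imports Defs
begin

text \<open>
  Put \<open>n = s - 1 + l * (p - 1)\<close> and \<open>F = ((1 + y)^p - 1) / y\<close>. Reading the last binomial
  coefficient as a coefficient of a power of \<open>1 + y\<close> and applying the binomial theorem twice
  identifies the double sum with the coefficient of \<open>y^n\<close> in \<open>(1 + y)^(s - 1) * F^m\<close>. Modulo \<open>p\<close>
  the polynomial \<open>F\<close> is \<open>y^(p - 1)\<close>, and \<open>n < (l + 1) * (p - 1)\<close> because \<open>s < p\<close>, so at least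
  \<open>m - l\<close> factors \<open>p\<close> occur in that coefficient. Over the rationals \<open>F = p * (1 + y * H)\<close> with
  \<open>H(0) = (p - 1) / 2\<close>, and expanding \<open>(1 + y * H)^m\<close> shows that the quotient is a combination of
  the polynomials \<open>m choose r\<close> for \<open>r \<le> n\<close>, where \<open>m choose n\<close> has the nonzero coefficient
  \<open>p^l * H(0)^n\<close>. A rational polynomial is periodic modulo 1 on the integers, so integrality at
  \<open>m \<ge> l\<close> implies integrality at all integers.
\<close>

section \<open>The polynomial F and the double sum as a coefficient\<close>

definition shifted_power :: "nat \<Rightarrow> 'a::comm_ring_1 poly" where
  "shifted_power p = (\<Sum>k<p. monom (of_nat (p choose Suc k)) k)"

lemma coeff_shifted_power: "coeff (shifted_power p) k = of_nat (p choose Suc k)"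
  by (auto simp: shifted_power_def coeff_sum not_less binomial_eq_0)

lemma coeff_one_plus_power: "coeff ([:1, 1:] ^ n) k = (of_nat (n choose k) :: 'a::comm_ring_1)"
proof (cases "k \<le> n")
  case True
  then show ?thesis by (simp add: coeff_linear_poly_power)
next
  case False
  have "degree ([:1, 1:] ^ n :: 'a poly) \<le> n"
    using degree_power_le[of "[:1, 1:] :: 'a poly" n] by simp
  with False show ?thesis by (simp add: coeff_eq_0 binomial_eq_0)
qed

text \<open>This identifies \<open>shifted_power p\<close> as the F above. Multiplying by y instead
  of dividing keeps it valid over any commutative ring: the integers serve for divisibility, the
  rationals for the degree.\<close>

lemma one_plus_power_eq:
  "[:1, 1:] ^ p = 1 + pCons 0 (shifted_power p :: 'a::comm_ring_1 poly)"
proof (rule poly_eqI)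
  fix k
  show "coeff ([:1, 1:] ^ p) k = coeff (1 + pCons 0 (shifted_power p :: 'a poly)) k"
    by (cases k) (simp_all add: coeff_one_plus_power coeff_shifted_power)
qed

lemma summand_eq_coeff:
  assumes "0 < p" and "0 < s" and "i \<le> j"
  shows "of_int (summand p l s m j i)
       = (of_nat (m choose j) * coeff (of_nat (j choose i) * ([:1, 1:] ^ (p - 1)) ^ i
            * (- 1) ^ (j - i) * [:1, 1:] ^ (j + s - 1)) (j + (s - 1 + l * (p - 1)))
          :: 'a::comm_ring_1)"
proof -
  have "of_nat (j choose i) * ([:1, 1:] ^ (p - 1)) ^ i * (- 1) ^ (j - i) * [:1, 1:] ^ (j + s - 1)
      = smult (of_nat (j choose i) * (- 1) ^ (j - i))
          ([:1, 1:] ^ (j + s - 1 + i * (p - 1)) :: 'a poly)"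
    by (cases "even (j - i)")
       (simp_all add: of_nat_poly power_add power_mult[symmetric] mult.commute)
  moreover have "j + s - 1 = j + (s - 1)"
    using assms by simp
  ultimately show ?thesis
    by (simp only: summand_def coeff_smult coeff_one_plus_power) (simp add: mult_ac add_ac)
qed

text \<open>For \<open>i < l\<close> the top of the last binomial coefficient is below its bottom.
  So the sums may start at 0, as the binomial theorem requires.\<close>

lemma summand_eq_0: "i < l \<Longrightarrow> 1 < p \<Longrightarrow> summand p l s m j i = 0"
  by (simp add: summand_def)

text \<open>With U = 1 + y, summing over i gives (U^(p-1) - 1)^j U^(j+s-1) = (U^p - U)^j U^(s-1).
  Since U^p - U = y (F - 1), the factor y^j cancels the shift by j in the index, and summing over j
  gives ((F - 1) + 1)^m.\<close>

lemma double_sum_eq_coeff: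
  assumes "1 < p" and "0 < s"
  shows "of_int (double_sum p l s m)
       = (coeff ([:1, 1:] ^ (s - 1) * shifted_power p ^ m) (s - 1 + l * (p - 1))
          :: 'a::comm_ring_1)"
proof -
  let ?n = "s - 1 + l * (p - 1)"
  let ?U = "[:1, 1:] :: 'a poly"
  let ?F = "shifted_power p :: 'a poly"
  have inner: "(\<Sum>i\<le>j. of_int (summand p l s m j i) :: 'a)
      = of_nat (m choose j) * coeff (?U ^ (s - 1) * (?F - 1) ^ j) ?n" for j
  proof -
    have "(\<Sum>i\<le>j. of_int (summand p l s m j i) :: 'a)
        = of_nat (m choose j) * coeff ((?U ^ (p - 1) + (- 1)) ^ j * ?U ^ (j + s - 1)) (j + ?n)"
      unfolding binomial_ring sum_distrib_right coeff_sum sum_distrib_left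
      by (rule sum.cong) (use assms in \<open>simp_all add: summand_eq_coeff\<close>)
    also have "(?U ^ (p - 1) + (- 1)) ^ j * ?U ^ (j + s - 1)
        = (?U ^ (p - 1) * ?U - ?U) ^ j * ?U ^ (s - 1)"
    proof -
      have "?U ^ (p - 1) * ?U - ?U = (?U ^ (p - 1) + (- 1)) * ?U"
        by (simp add: algebra_simps del: mult_pCons_left mult_pCons_right)
      moreover have "j + s - 1 = j + (s - 1)"
        using assms by simp
      ultimately show ?thesis
        by (simp add: power_mult_distrib power_add mult.assoc del: mult_pCons_left mult_pCons_right)
    qed
    also have "?U ^ (p - 1) * ?U = ?U ^ p"
      using assms by (metis power_minus_mult gr_implies_not0 not_gr_zero)
    also have "?U ^ p - ?U = monom 1 1 * (?F - 1)"
      by (simp add: one_plus_power_eq monom_altdef one_pCons)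
    also have "coeff ((monom 1 1 * (?F - 1)) ^ j * ?U ^ (s - 1)) (j + ?n)
        = coeff (monom 1 j * (?U ^ (s - 1) * (?F - 1) ^ j)) (j + ?n)"
      by (simp add: power_mult_distrib monom_power mult_ac)
    also have "\<dots> = coeff (?U ^ (s - 1) * (?F - 1) ^ j) ?n"
      by (simp add: coeff_monom_mult)
    finally show ?thesis .
  qed
  have "double_sum p l s m = (\<Sum>j=l..m. \<Sum>i=l..j. summand p l s m j i)"
    by (rule double_sum_eq)
  also have "\<dots> = (\<Sum>j=l..m. \<Sum>i\<le>j. summand p l s m j i)"
    by (intro sum.cong sum.mono_neutral_left refl) (use assms in \<open>auto simp: summand_eq_0\<close>)
  also have "\<dots> = (\<Sum>j\<le>m. \<Sum>i\<le>j. summand p l s m j i)"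
    by (rule sum.mono_neutral_left)
       (use assms in \<open>auto intro!: sum.neutral simp: summand_eq_0\<close>)
  finally have "of_int (double_sum p l s m)
      = (\<Sum>j\<le>m. of_nat (m choose j) * coeff (?U ^ (s - 1) * (?F - 1) ^ j) ?n)"
    by (simp add: inner)
  also have "\<dots> = coeff (?U ^ (s - 1) * ((?F - 1) + 1) ^ m) ?n"
    unfolding binomial_ring sum_distrib_left coeff_sum
    by (rule sum.cong) (simp_all add: of_nat_poly mult_ac)
  finally show ?thesis by simp
qed

section \<open>Divisibility by powers of p\<close>

lemma prime_dvd_shifted_power:
  assumes "prime p"
  shows "[:int p:] dvd shifted_power p - monom 1 (p - 1)"
proof -
  have "int p dvd coeff (shifted_power p - monom 1 (p - 1)) k" for k
  proof (cases "k < p - 1")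
    case True
    then show ?thesis
      using assms by (simp add: coeff_shifted_power dvd_choose_prime)
  next
    case False
    then show ?thesis
      using prime_gt_0_nat[OF assms] by (cases "k = p - 1") (auto simp: coeff_shifted_power binomial_eq_0)
  qed
  then show ?thesis by (simp add: const_poly_dvd_iff)
qed

lemma power_dvd_double_sum:
  assumes "prime p" and "0 < s" and "s < p"
  shows "int p ^ (m - l) dvd double_sum p l s m"
proof -
  let ?n = "s - 1 + l * (p - 1)"
  let ?V = "[:1, 1:] ^ (s - 1) :: int poly"
  obtain G :: "int poly" where "shifted_power p - monom 1 (p - 1) = [:int p:] * G"
    using prime_dvd_shifted_power[OF assms(1)] by (elim dvdE)
  then have F: "shifted_power p = smult (int p) G + monom 1 (p - 1)"
    by (simp add: algebra_simps)
  have "double_sum p l s m = coeff (?V * shifted_power p ^ m) ?n"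
    using double_sum_eq_coeff[where 'a = int] assms prime_gt_1_nat by simp
  also have "\<dots> = (\<Sum>k\<le>m. coeff (?V * (of_nat (m choose k) * smult (int p) G ^ k
                              * monom 1 (p - 1) ^ (m - k))) ?n)"
    unfolding F binomial_ring sum_distrib_left coeff_sum ..
  also have "int p ^ (m - l) dvd \<dots>"
  proof (rule dvd_sum)
    fix k assume "k \<in> {..m}"
    let ?c = "?V * (of_nat (m choose k) * G ^ k)"
    have eq: "?V * (of_nat (m choose k) * smult (int p) G ^ k * monom 1 (p - 1) ^ (m - k))
        = smult (int p ^ k) (monom 1 ((p - 1) * (m - k)) * ?c)"
      by (simp add: smult_power monom_power mult_ac)
    show "int p ^ (m - l) dvd
        coeff (?V * (of_nat (m choose k) * smult (int p) G ^ k * monom 1 (p - 1) ^ (m - k))) ?n"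
    proof (cases "m - l \<le> k")
      case True
      then show ?thesis unfolding eq by (simp add: le_imp_power_dvd)
    next
      case False
      \<comment> \<open>With fewer than \<open>m - l\<close> factors p, at least
        \<open>l + 1\<close> factors y^(p-1) remain; their product has order above \<open>?n\<close>
        because s - 1 < p - 1, so this term contributes 0.\<close>
      have "?n < (p - 1) * Suc l"
        using assms by (simp add: mult.commute)
      also have "\<dots> \<le> (p - 1) * (m - k)"
        using False by (intro mult_left_mono) auto
      finally show ?thesis unfolding eq by (simp add: coeff_monom_mult)
    qed
  qed
  finally show ?thesis .
qed

lemma double_sum_eq_0: "m < l \<Longrightarrow> double_sum p l s m = 0"
  by (simp add: double_sum_eq)

section \<open>Binomial polynomials and integrality of rational polynomials\<close>

definition binomial_poly :: "nat \<Rightarrow> 'a::field_char_0 poly" where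
  "binomial_poly r = smult (1 / fact r) (\<Prod>i<r. [:- of_nat i, 1:])"

lemma poly_binomial_poly: "poly (binomial_poly r) (of_nat m) = of_nat (m choose r)"
  by (simp add: binomial_poly_def poly_prod binomial_gbinomial gbinomial_prod_rev
        atLeast0LessThan)

lemma degree_binomial_poly: "degree (binomial_poly r) = r"
  by (simp add: binomial_poly_def degree_prod_sum_eq)

lemma rat_poly_periodic_mod_Ints:
  fixes Q :: "rat poly"
  shows "\<exists>D>0. \<forall>x t. poly Q (of_int (x + D * t)) - poly Q (of_int x) \<in> \<int>"
proof -
  \<comment> \<open>The induction also needs D to clear the denominators of all values of Q at
    integers.\<close>
  have "\<exists>D>0. \<forall>x t. of_int D * poly Q (of_int x) \<in> \<int> \<and>
      poly Q (of_int (x + D * t)) - poly Q (of_int x) \<in> \<int>"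
  proof (induction Q)
    case 0
    show ?case by (auto intro: exI[of _ 1])
  next
    case (pCons a Q)
    then obtain D where "D > 0"
      and int: "of_int D * poly Q (of_int x) \<in> \<int>"
      and diff: "poly Q (of_int (x + D * t)) - poly Q (of_int x) \<in> \<int>" for x t
      by blast
    obtain b c where bc: "a = of_int b / of_int c" "c > 0"
      by (metis Fract_of_int_quotient Rat_cases)
    show ?case
    proof (intro exI conjI allI)
      show "c * D > 0"
        using bc \<open>D > 0\<close> by simp
      fix x t
      have "of_int (c * D) * poly (pCons a Q) (of_int x)
          = of_int (D * b) + of_int (c * x) * (of_int D * poly Q (of_int x))"
        using bc by (simp add: field_simps)
      then show "of_int (c * D) * poly (pCons a Q) (of_int x) \<in> \<int>"
        by (metis int Ints_add Ints_mult Ints_of_int)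
      \<comment> \<open>The constant a cancels, and y Q(y) - x Q(x) = x (Q(y) - Q(x)) + (y - x)
        Q(y), where y - x is a multiple of D.\<close>
      let ?y = "x + c * D * t"
      have "poly (pCons a Q) (of_int ?y) - poly (pCons a Q) (of_int x)
          = of_int x * (poly Q (of_int (x + D * (c * t))) - poly Q (of_int x))
            + of_int (c * t) * (of_int D * poly Q (of_int ?y))"
        by (simp add: algebra_simps)
      then show "poly (pCons a Q) (of_int ?y) - poly (pCons a Q) (of_int x) \<in> \<int>"
        by (metis int diff Ints_add Ints_mult Ints_of_int)
    qed
  qed
  then show ?thesis by blast
qed

lemma rat_poly_Ints_if_eventually:
  fixes Q :: "rat poly"
  assumes "\<And>m::nat. m \<ge> l \<Longrightarrow> poly Q (of_nat m) \<in> \<int>"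
  shows "poly Q (of_int x) \<in> \<int>"
proof -
  obtain D where "D > 0" and D: "\<And>x t. poly Q (of_int (x + D * t)) - poly Q (of_int x) \<in> \<int>"
    using rat_poly_periodic_mod_Ints by blast
  \<comment> \<open>This m is congruent to x modulo D, and m >= l because D >= 1 and x + |x| >=
    0.\<close>
  define m where "m = x + D * (int l + \<bar>x\<bar>)"
  have "int l + \<bar>x\<bar> \<le> D * (int l + \<bar>x\<bar>)"
    using \<open>D > 0\<close> mult_right_mono[of 1 D "int l + \<bar>x\<bar>"] by simp
  then have "m \<ge> int l"
    by (simp add: m_def)
  then have "poly Q (of_nat (nat m)) \<in> \<int>"
    by (intro assms) simp
  moreover have "of_nat (nat m) = (of_int m :: rat)"
    using \<open>m \<ge> int l\<close> by simp
  moreover have "poly Q (of_int m) - poly Q (of_int x) \<in> \<int>"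
    unfolding m_def by (rule D)
  ultimately show ?thesis
    by (metis Ints_diff diff_diff_eq2 add_diff_cancel_left')
qed

section \<open>The quotient as a polynomial in m\<close>

lemma degree_sum_graded:
  fixes f :: "nat \<Rightarrow> 'a::field_char_0 poly"
  assumes "\<And>r. degree (f r) = r" and "c n \<noteq> 0"
  shows "degree (\<Sum>r\<le>n. smult (c r) (f r)) = n"
proof (cases n)
  case 0
  with assms show ?thesis by simp
next
  case (Suc k)
  have "degree (\<Sum>r\<le>k. smult (c r) (f r)) \<le> k"
    using assms(1) by (intro degree_sum_le) (auto intro: order_trans[OF degree_smult_le])
  with assms Suc show ?thesis
    by (simp add: degree_add_eq_right)
qed

text \<open>The r-th binomial term is divisible by y^r, so only r \<le> n matters. A range
  independent of m is what makes the coefficient polynomial in m.\<close>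

lemma coeff_power_one_plus:
  fixes V H :: "'a::comm_ring_1 poly"
  shows "coeff (V * (1 + pCons 0 H) ^ m) n
       = (\<Sum>r\<le>n. of_nat (m choose r) * coeff (V * H ^ r) (n - r))"
proof -
  let ?c = "\<lambda>r. of_nat (m choose r) * (if r \<le> n then coeff (V * H ^ r) (n - r) else 0)"
  have "coeff (V * (pCons 0 H + 1) ^ m) n = (\<Sum>r\<le>m. ?c r)"
    unfolding binomial_ring sum_distrib_left coeff_sum
  proof (rule sum.cong)
    fix r
    have "V * (of_nat (m choose r) * pCons 0 H ^ r * 1 ^ (m - r))
        = smult (of_nat (m choose r)) (monom 1 r * (V * H ^ r))"
    proof -
      have "pCons 0 H = monom 1 1 * H"
        by (simp add: monom_altdef)
      then show ?thesis
        by (simp add: of_nat_poly power_mult_distrib monom_power mult_ac)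
    qed
    then show "coeff (V * (of_nat (m choose r) * pCons 0 H ^ r * 1 ^ (m - r))) n = ?c r"
      by (simp add: coeff_monom_mult)
  qed simp
  also have "\<dots> = (\<Sum>r\<le>n. ?c r)"
    by (rule sum.mono_neutral_cong) (auto simp: not_le binomial_eq_0)
  finally show ?thesis
    by (simp add: add.commute)
qed

lemma double_sum_eq_poly:
  assumes "1 < p" and "0 < s"
  obtains Q :: "rat poly" where "degree Q = s - 1 + l * (p - 1)"
    and "\<And>m. of_int (double_sum p l s m) = of_nat p ^ m * poly Q (of_nat m)"
proof -
  let ?n = "s - 1 + l * (p - 1)"
  let ?V = "[:1, 1:] ^ (s - 1) :: rat poly"
  obtain a H where aH: "smult (1 / of_nat p) (shifted_power p) = pCons a (H :: rat poly)"
    by (meson pCons_cases)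
  have a: "a = 1"
    using arg_cong[OF aH, of "\<lambda>P. coeff P 0"] assms by (simp add: coeff_shifted_power)
  have F: "shifted_power p = smult (of_nat p) (1 + pCons 0 H)"
    using arg_cong[OF aH, of "smult (of_nat p)"] assms a by (simp add: one_pCons)
  \<comment> \<open>The value is (p choose 2) / p = (p - 1) / 2. As (1 + y)^(s - 1) has constant
    term 1, \<open>c ?n\<close> is the \<open>?n\<close>-th power of this value.\<close>
  have H0: "coeff H 0 \<noteq> 0"
    using arg_cong[OF aH, of "\<lambda>P. coeff P 1"] assms by (auto simp: coeff_shifted_power binomial_eq_0)
  define c where "c r = coeff (?V * H ^ r) (?n - r)" for r
  have "c ?n \<noteq> 0"
    using H0 by (simp add: c_def coeff_mult_0 coeff_0_power)
  show ?thesis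
  proof
    show "degree (\<Sum>r\<le>?n. smult (c r) (binomial_poly r)) = ?n"
      by (rule degree_sum_graded) (use \<open>c ?n \<noteq> 0\<close> in \<open>simp_all add: degree_binomial_poly\<close>)
    fix m
    have "of_int (double_sum p l s m) = of_nat p ^ m * coeff (?V * (1 + pCons 0 H) ^ m) ?n"
      using double_sum_eq_coeff[where 'a = rat] assms by (simp add: F smult_power)
    also have "coeff (?V * (1 + pCons 0 H) ^ m) ?n
        = poly (\<Sum>r\<le>?n. smult (c r) (binomial_poly r)) (of_nat m)"
      by (simp add: coeff_power_one_plus poly_sum poly_binomial_poly c_def mult.commute[of "coeff _ _"])
    finally show "of_int (double_sum p l s m) = of_nat p ^ m *
        poly (\<Sum>r\<le>?n. smult (c r) (binomial_poly r)) (of_nat m)" .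
  qed
qed

theorem theorem6p3:
  fixes p l s :: nat
  assumes "prime p" and "0 < s" and "s < p"
  shows "(\<forall>m\<ge>l. [double_sum p l s m = 0] (mod (int p ^ (m - l))))
    \<and> (\<forall>m<l. \<exists>k::int. rat_of_int (double_sum p l s m)
                       = rat_of_nat p powi (int m - int l) * rat_of_int k)
    \<and> (\<exists>Q :: rat poly.
          Q \<noteq> 0 \<and> degree Q = s - 1 + l * (p - 1)
        \<and> (\<forall>x::int. poly Q (rat_of_int x) \<in> \<int>)
        \<and> (\<forall>m::nat. rat_of_int (double_sum p l s m)
                     = rat_of_nat p powi (int m - int l) * poly Q (rat_of_nat m)))"
proof -
  have p: "1 < p"
    using assms prime_gt_1_nat by blast
  obtain R :: "rat poly" where degR: "degree R = s - 1 + l * (p - 1)"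
    and R: "\<And>m. of_int (double_sum p l s m) = of_nat p ^ m * poly R (of_nat m)"
    using double_sum_eq_poly[OF p assms(2)] by metis
  \<comment> \<open>The factor p^l turns p^m into p^(m - l), also for m < l, where the exponent is
    negative.\<close>
  define Q where "Q = smult (of_nat p ^ l) R"
  have eq: "of_int (double_sum p l s m)
      = of_nat p powi (int m - int l) * poly Q (of_nat m)" for m
    using p by (simp add: R Q_def power_int_diff)
  \<comment> \<open>The degree does not exclude Q = 0 when s = 1 and l = 0. At m = l only the term j
    = i = l remains, and it equals 1.\<close>
  have "Q \<noteq> 0"
  proof
    assume "Q = 0"
    then have "double_sum p l s l = 0"
      using eq[of l] by simp
    moreover have "double_sum p l s l = 1"
      by (simp add: double_sum_eq summand_def)
    ultimately show False by simp
  qed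
  moreover have "degree Q = s - 1 + l * (p - 1)"
    using degR p by (simp add: Q_def)
  moreover have "poly Q (of_int x) \<in> \<int>" for x
  proof (rule rat_poly_Ints_if_eventually)
    fix m assume "l \<le> m"
    obtain k where "double_sum p l s m = int p ^ (m - l) * k"
      using power_dvd_double_sum[OF assms] by (metis dvdE)
    then have "of_nat p ^ (m - l) * poly Q (of_nat m) = of_nat p ^ (m - l) * of_int k"
      using eq[of m] \<open>l \<le> m\<close> p by (auto simp flip: of_nat_diff)
    then show "poly Q (of_nat m) \<in> \<int>"
      using p by simp
  qed
  moreover have "[double_sum p l s m = 0] (mod int p ^ (m - l))" for m
    using power_dvd_double_sum[OF assms] by (simp add: cong_0_iff)
  moreover have "\<exists>k::int. rat_of_int (double_sum p l s m)
      = rat_of_nat p powi (int m - int l) * rat_of_int k" if "m < l" for m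
    using that by (intro exI[of _ 0]) (simp add: double_sum_eq_0)
  ultimately show ?thesis
    using eq by blast
qed

end
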